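(* Let $x,y\in{}^\bullet\mathbb{R}$ with $x>0$, $y>0$, and let $p\in\mathbb{R}_{>0}$. Suppose that $$\forall i=1,\dots,N_y\ \ \forall j=1,\dots,N_x:\quad\omega_i(y)\oplus\omega_j(x)\ge1,$$ where $N_x$ and $N_y$ are the numbers of (infinitesimal) summands in the decompositions of $x$ and $y$ respectively. Then $(x\cdot y)^p=x^p\cdot y^p$.
   Context: Fermat reals. A little-oh polynomial is a function $x:\mathbb{R}_{\ge0}\to\mathbb{R}$ such that $x(t)=r+\sum_{i=1}^N a_i t^{\alpha_i}+o(t)$ as $t\to0^+$, for some $N\in\mathbb{N}$, $r,a_i\in\mathbb{R}$, $\alpha_i\in\mathbb{R}_{\ge0}$. Put $x\sim y$ iff $x(t)=y(t)+o(t)$ as $t\to0^+$. The ring ${}^\bullet\mathbb{R}$ of Fermat reals is the quotient of the ring of little-oh polynomials (pointwise operations) by $\sim$; it contains $\mathbb{R}$. For real $a>0$, $\mathrm{d}t_a$ denotes the class of $t\mapsto t^{1/a}$ (so $\mathrm{d}t_a=0$ iff $a<1$). Every $x\in{}^\bullet\mathbb{R}$ can be written uniquely as $x={}^\circ x+\sum_{i=1}^{N_x}{}^\circ x_i\,\mathrm{d}t_{\omega_i(x)}$ with ${}^\circ x,{}^\circ x_i\in\mathbb{R}$, ${}^\circ x_i\ne0$, $\omega_1(x)>\dots>\omega_{N_x}(x)\ge1$, $N_x\ge0$ (the decomposition of $x$). Order relation: $x>0$ iff ${}^\circ x>0$, or ${}^\circ x=0$, $x\ne0$ and ${}^\circ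 x_1>0$. $D_\infty:=\{x\mid{}^\circ x=0\}$. For $a,b\in(0,\infty]$ put $a\oplus b:=(\frac1a+\frac1b)^{-1}$, $a\ominus b:=(\frac1a-\frac1b)^{-1}$, with $1/\infty=0$, $1/0=\infty$. Powers. For $y\in{}^\bullet\mathbb{R}$ with ${}^\circ y>0$ and $p\in\mathbb{R}$, $y^p$ is the class of $t\mapsto y(t)^p$; in particular $(1+h)^p=1+\sum_{n\ge1}\binom pn h^n$ (a finite sum) for $h\in D_\infty$. For $c\in D_\infty$, $c>0$, and $p\in\mathbb{R}_{>0}$, with $\omega(c):=\omega_1(c)$, $$c^p:=({}^\circ c_1)^p\,\mathrm{d}t_{\frac{\omega(c)}p}\cdot\left(1+\sum_{i=2}^{N_c}\frac{{}^\circ c_i}{{}^\circ c_1}\,\mathrm{d}t_{\omega_i(c)\ominus\omega(c)}\right)^p .$$ *)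

theory Defs
  imports "HOL-Analysis.Analysis" "HOL-Real_Asymp.Real_Asymp"
begin

section \<open>Little-oh polynomials\<close>

text \<open>
  Only the germ of a function at 0 from the right matters, so little-oh polynomials are
  represented by total functions on the reals, and the limits are taken along
  \<^term>\<open>at_right (0::real)\<close>.
\<close>

definition little_oh_poly :: "(real \<Rightarrow> real) \<Rightarrow> bool" where
  "little_oh_poly x \<longleftrightarrow>
     (\<exists>(N::nat) (r::real) (a::nat \<Rightarrow> real) (\<alpha>::nat \<Rightarrow> real).
        (\<forall>i\<in>{1..N}. \<alpha> i \<ge> 0) \<and>
        (\<lambda>t. x t - (r + (\<Sum>i=1..N. a i * t powr \<alpha> i))) \<in> o[at_right 0](\<lambda>t. t))"

definition gpoly :: "(real \<times> real) list \<Rightarrow> real \<Rightarrow> real" where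
  "gpoly cs t = (\<Sum>(a, \<alpha>)\<leftarrow>cs. a * t powr \<alpha>)"

lemma gpoly_simps [simp]:
  "gpoly [] t = 0"
  "gpoly ((a, \<alpha>) # cs) t = a * t powr \<alpha> + gpoly cs t"
  "gpoly (cs @ ds) t = gpoly cs t + gpoly ds t"
  by (simp_all add: gpoly_def)

lemma eventually_pos_at_right_0: "eventually (\<lambda>t::real. t > 0) (at_right 0)"
  by (simp add: eventually_at_right_less)

lemma little_oh_poly_iff_gpoly:
  "little_oh_poly x \<longleftrightarrow>
     (\<exists>cs. (\<forall>(a, \<alpha>)\<in>set cs. \<alpha> \<ge> 0) \<and> (\<lambda>t. x t - gpoly cs t) \<in> o[at_right 0](\<lambda>t. t))"
proof
  assume "little_oh_poly x"
  then obtain N :: nat and r a \<alpha> where *: "\<forall>i\<in>{1..N}. \<alpha> i \<ge> 0"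
    "(\<lambda>t. x t - (r + (\<Sum>i=1..N. a i * t powr \<alpha> i))) \<in> o[at_right 0](\<lambda>t. t)"
    unfolding little_oh_poly_def by blast
  define cs where "cs = (r, 0) # map (\<lambda>i. (a i, \<alpha> i)) [1..<Suc N]"
  have "gpoly cs t = r + (\<Sum>i=1..N. a i * t powr \<alpha> i)" if "t > 0" for t
  proof -
    have "(\<Sum>i\<leftarrow>[1..<Suc N]. a i * t powr \<alpha> i) = (\<Sum>i=1..N. a i * t powr \<alpha> i)"
      by (simp only: interv_sum_list_conv_sum_set_nat set_upt atLeastLessThanSuc_atLeastAtMost)
    then show ?thesis
      using that unfolding cs_def gpoly_def by (simp add: comp_def del: upt_Suc)
  qed
  then have "eventually (\<lambda>t. x t - gpoly cs t = x t - (r + (\<Sum>i=1..N. a i * t powr \<alpha> i))) (at_right 0)"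
    using eventually_mono[OF eventually_pos_at_right_0] by simp
  then have "(\<lambda>t. x t - gpoly cs t) \<in> o[at_right 0](\<lambda>t. t)"
    using *(2) by (subst landau_o.small.in_cong)
  moreover have "\<forall>(a, \<alpha>)\<in>set cs. \<alpha> \<ge> 0"
    using *(1) by (auto simp: cs_def)
  ultimately show "\<exists>cs. (\<forall>(a, \<alpha>)\<in>set cs. \<alpha> \<ge> 0) \<and> (\<lambda>t. x t - gpoly cs t) \<in> o[at_right 0](\<lambda>t. t)"
    by blast
next
  assume "\<exists>cs. (\<forall>(a, \<alpha>)\<in>set cs. \<alpha> \<ge> 0) \<and> (\<lambda>t. x t - gpoly cs t) \<in> o[at_right 0](\<lambda>t. t)"
  then obtain cs where cs: "\<forall>(a, \<alpha>)\<in>set cs. \<alpha> \<ge> 0"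
    "(\<lambda>t. x t - gpoly cs t) \<in> o[at_right 0](\<lambda>t. t)" by blast
  have eq: "gpoly cs t = 0 + (\<Sum>i=1..length cs. fst (cs ! (i - 1)) * t powr snd (cs ! (i - 1)))" for t
    unfolding gpoly_def sum_list_sum_nth
    by (simp add: case_prod_beta)
       (rule sum.reindex_bij_witness[of _ "\<lambda>i. i - 1" Suc], auto)
  have "\<forall>i\<in>{1..length cs}. snd (cs ! (i - 1)) \<ge> 0"
    using cs(1) by (auto simp: case_prod_beta)
  then show "little_oh_poly x"
    using cs(2) unfolding eq little_oh_poly_def
    by (intro exI[of _ "length cs"] exI[of _ 0] exI[of _ "\<lambda>i. fst (cs ! (i - 1))"]
              exI[of _ "\<lambda>i. snd (cs ! (i - 1))"]) auto
qed

lemma little_oh_poly_gpoly: "(\<forall>(a, \<alpha>)\<in>set cs. \<alpha> \<ge> 0) \<Longrightarrow> little_oh_poly (gpoly cs)"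
  unfolding little_oh_poly_iff_gpoly by (rule exI[of _ cs]) auto

lemma little_oh_poly_cong:
  assumes "little_oh_poly g" "(\<lambda>t. f t - g t) \<in> o[at_right 0](\<lambda>t. t)"
  shows "little_oh_poly f"
proof -
  obtain cs where cs: "\<forall>(a, \<alpha>)\<in>set cs. \<alpha> \<ge> 0" "(\<lambda>t. g t - gpoly cs t) \<in> o[at_right 0](\<lambda>t. t)"
    using assms(1) unfolding little_oh_poly_iff_gpoly by blast
  have "(\<lambda>t. (f t - g t) + (g t - gpoly cs t)) \<in> o[at_right 0](\<lambda>t. t)"
    using assms(2) cs(2) by (rule sum_in_smallo)
  then show ?thesis
    using cs(1) unfolding little_oh_poly_iff_gpoly by auto
qed

lemma little_oh_poly_monom: "\<alpha> \<ge> 0 \<Longrightarrow> little_oh_poly (\<lambda>t. a * t powr \<alpha>)"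
  using little_oh_poly_gpoly[of "[(a, \<alpha>)]"] by (simp add: gpoly_def[abs_def])

lemma little_oh_poly_const: "little_oh_poly (\<lambda>_. r)"
  unfolding little_oh_poly_def
  by (intro exI[of _ "0::nat"] exI[of _ r]) simp

lemma little_oh_poly_add:
  assumes "little_oh_poly f" "little_oh_poly g"
  shows "little_oh_poly (\<lambda>t. f t + g t)"
proof -
  obtain cs where cs: "\<forall>(a, \<alpha>)\<in>set cs. \<alpha> \<ge> 0" "(\<lambda>t. f t - gpoly cs t) \<in> o[at_right 0](\<lambda>t. t)"
    using assms(1) unfolding little_oh_poly_iff_gpoly by blast
  obtain ds where ds: "\<forall>(a, \<alpha>)\<in>set ds. \<alpha> \<ge> 0" "(\<lambda>t. g t - gpoly ds t) \<in> o[at_right 0](\<lambda>t. t)"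
    using assms(2) unfolding little_oh_poly_iff_gpoly by blast
  have "(\<lambda>t. (f t - gpoly cs t) + (g t - gpoly ds t)) \<in> o[at_right 0](\<lambda>t. t)"
    using cs(2) ds(2) by (rule sum_in_smallo)
  then show ?thesis
    using cs(1) ds(1) unfolding little_oh_poly_iff_gpoly
    by (intro exI[of _ "cs @ ds"]) (auto simp: algebra_simps)
qed

lemma little_oh_poly_expand:
  assumes "little_oh_poly f"
  obtains r \<epsilon> where "\<epsilon> > 0" "(\<lambda>t. f t - r) \<in> O[at_right 0](\<lambda>t. t powr \<epsilon>)"
proof -
  have mono: "(\<lambda>t::real. t powr a) \<in> O[at_right 0](\<lambda>t. t powr b)" if "b \<le> a" for a b :: real
  proof (rule bigoI[of _ 1])
    have "eventually (\<lambda>t::real. t \<in> {0<..<1}) (at_right 0)"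
      by (rule eventually_at_right_real) simp
    then show "eventually (\<lambda>t::real. norm (t powr a) \<le> 1 * norm (t powr b)) (at_right 0)"
      by eventually_elim (use that in \<open>auto intro: powr_mono'\<close>)
  qed
  have sum: "(\<lambda>t. u t + v t) \<in> O[at_right 0](\<lambda>t. t powr min a b)"
    if "u \<in> O[at_right 0](\<lambda>t. t powr a)" "v \<in> O[at_right 0](\<lambda>t. t powr b)" for u v :: "real \<Rightarrow> real" and a b
    using landau_o.big_trans[OF that(1) mono[of "min a b" a]]
      landau_o.big_trans[OF that(2) mono[of "min a b" b]] by (intro sum_in_bigo) auto
  have *: "\<exists>r \<epsilon>. \<epsilon> > 0 \<and> (\<lambda>t. gpoly cs t - r) \<in> O[at_right 0](\<lambda>t. t powr \<epsilon>)"
    if "\<forall>(a, \<alpha>)\<in>set cs. \<alpha> \<ge> 0" for cs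
    using that
  proof (induction cs)
    case Nil
    show ?case by (intro exI[of _ 0] exI[of _ 1]) simp
  next
    case (Cons c cs)
    obtain a \<alpha> where c: "c = (a, \<alpha>)" by (cases c)
    obtain r \<epsilon> where r: "\<epsilon> > 0" "(\<lambda>t. gpoly cs t - r) \<in> O[at_right 0](\<lambda>t. t powr \<epsilon>)"
      using Cons by auto
    show ?case
    proof (cases "\<alpha> = 0")
      case True
      have "eventually (\<lambda>t. gpoly (c # cs) t - (a + r) = gpoly cs t - r) (at_right 0)"
        using eventually_pos_at_right_0 by eventually_elim (simp add: c True)
      then have "(\<lambda>t. gpoly (c # cs) t - (a + r)) \<in> O[at_right 0](\<lambda>t. t powr \<epsilon>)"
        using r(2) by (subst landau_o.big.in_cong)
      then show ?thesis using r(1) by blast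
    next
      case False
      then have "\<alpha> > 0" using Cons.prems by (simp add: c)
      moreover have "(\<lambda>t. a * t powr \<alpha> + (gpoly cs t - r)) \<in> O[at_right 0](\<lambda>t. t powr min \<alpha> \<epsilon>)"
        by (intro sum r(2)) simp
      ultimately show ?thesis
        using r(1) by (intro exI[of _ r] exI[of _ "min \<alpha> \<epsilon>"]) (auto simp: c algebra_simps)
    qed
  qed
  obtain cs where cs: "\<forall>(a, \<alpha>)\<in>set cs. \<alpha> \<ge> 0" "(\<lambda>t. f t - gpoly cs t) \<in> o[at_right 0](\<lambda>t. t)"
    using assms(1) unfolding little_oh_poly_iff_gpoly by blast
  obtain r \<epsilon> where r: "\<epsilon> > 0" "(\<lambda>t. gpoly cs t - r) \<in> O[at_right 0](\<lambda>t. t powr \<epsilon>)"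
    using *[OF cs(1)] by blast
  have "eventually (\<lambda>t::real. t = t powr 1) (at_right 0)"
    using eventually_pos_at_right_0 by eventually_elim simp
  then have "(\<lambda>t::real. t) \<in> O[at_right 0](\<lambda>t. t powr 1)"
    using landau_o.big.in_cong[of "\<lambda>t. t" "\<lambda>t. t powr 1"] by simp
  then have "(\<lambda>t. f t - gpoly cs t) \<in> O[at_right 0](\<lambda>t. t powr 1)"
    using landau_o.small_imp_big[OF cs(2)] landau_o.big_trans by blast
  from sum[OF this r(2)] have "(\<lambda>t. f t - r) \<in> O[at_right 0](\<lambda>t. t powr min 1 \<epsilon>)"
    by simp
  then show ?thesis using r(1) by (intro that[of "min 1 \<epsilon>" r]) auto
qed

lemma powr_tendsto_0_at_right: "\<epsilon> > 0 \<Longrightarrow> ((\<lambda>t::real. t powr \<epsilon>) \<longlongrightarrow> 0) (at_right 0)"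
  by real_asymp

lemma little_oh_poly_tendsto:
  assumes "little_oh_poly f"
  obtains r where "(f \<longlongrightarrow> r) (at_right 0)"
proof -
  obtain r \<epsilon> where r: "\<epsilon> > 0" "(\<lambda>t. f t - r) \<in> O[at_right 0](\<lambda>t. t powr \<epsilon>)"
    using little_oh_poly_expand[OF assms] .
  have "(\<lambda>t::real. t powr \<epsilon>) \<in> o[at_right 0](\<lambda>_. 1)"
    using powr_tendsto_0_at_right[OF r(1)] by (intro smalloI_tendsto) auto
  then have "(\<lambda>t. f t - r) \<in> o[at_right 0](\<lambda>_. 1)"
    using r(2) landau_o.big_small_trans by blast
  from smalloD_tendsto[OF this] have "(f \<longlongrightarrow> r) (at_right 0)"
    by (simp add: LIM_zero_iff)
  then show ?thesis by (rule that)
qed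

lemma little_oh_poly_bigo:
  assumes "little_oh_poly f"
  shows "f \<in> O[at_right 0](\<lambda>_. 1)"
proof -
  obtain r where "(f \<longlongrightarrow> r) (at_right 0)" using little_oh_poly_tendsto[OF assms] .
  then show ?thesis by (intro bigoI_tendsto[of _ _ r]) auto
qed

lemma little_oh_poly_mult:
  assumes "little_oh_poly f" "little_oh_poly g"
  shows "little_oh_poly (\<lambda>t. f t * g t)"
proof -
  have monom: "little_oh_poly (\<lambda>t. (a * t powr \<alpha>) * gpoly ds t)"
    if "\<alpha> \<ge> 0" "\<forall>(a, \<alpha>)\<in>set ds. \<alpha> \<ge> 0" for a \<alpha> ds
    using that(2)
  proof (induction ds)
    case Nil
    show ?case using little_oh_poly_const[of 0] by simp
  next
    case (Cons d ds)
    obtain b \<beta> where d: "d = (b, \<beta>)" by (cases d)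
    have "little_oh_poly (\<lambda>t. (a * b) * t powr (\<alpha> + \<beta>) + (a * t powr \<alpha>) * gpoly ds t)"
      using Cons that(1) by (intro little_oh_poly_add little_oh_poly_monom) (auto simp: d)
    then show ?case
      by (simp add: d powr_add algebra_simps)
  qed
  have prod: "little_oh_poly (\<lambda>t. gpoly cs t * gpoly ds t)"
    if "\<forall>(a, \<alpha>)\<in>set cs. \<alpha> \<ge> 0" "\<forall>(a, \<alpha>)\<in>set ds. \<alpha> \<ge> 0" for cs ds
    using that(1)
  proof (induction cs)
    case Nil
    show ?case using little_oh_poly_const[of 0] by simp
  next
    case (Cons c cs)
    obtain a \<alpha> where c: "c = (a, \<alpha>)" by (cases c)
    have "little_oh_poly (\<lambda>t. (a * t powr \<alpha>) * gpoly ds t + gpoly cs t * gpoly ds t)"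
      using Cons that(2) by (intro little_oh_poly_add monom) (auto simp: c)
    then show ?case
      by (simp add: c distrib_right)
  qed
  obtain cs where cs: "\<forall>(a, \<alpha>)\<in>set cs. \<alpha> \<ge> 0" "(\<lambda>t. f t - gpoly cs t) \<in> o[at_right 0](\<lambda>t. t)"
    using assms(1) unfolding little_oh_poly_iff_gpoly by blast
  obtain ds where ds: "\<forall>(a, \<alpha>)\<in>set ds. \<alpha> \<ge> 0" "(\<lambda>t. g t - gpoly ds t) \<in> o[at_right 0](\<lambda>t. t)"
    using assms(2) unfolding little_oh_poly_iff_gpoly by blast
  have "(\<lambda>t. (f t - gpoly cs t) * g t + gpoly cs t * (g t - gpoly ds t)) \<in> o[at_right 0](\<lambda>t. t)"
    using landau_o.small_big_mult[OF cs(2) little_oh_poly_bigo[OF assms(2)]]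
      landau_o.big_small_mult[OF little_oh_poly_bigo[OF little_oh_poly_gpoly[OF cs(1)]] ds(2)]
    by (intro sum_in_smallo) simp_all
  then have "(\<lambda>t. f t * g t - gpoly cs t * gpoly ds t) \<in> o[at_right 0](\<lambda>t. t)"
    by (simp add: algebra_simps)
  then show ?thesis
    by (rule little_oh_poly_cong[OF prod[OF cs(1) ds(1)]])
qed

lemma little_oh_poly_cmult: "little_oh_poly f \<Longrightarrow> little_oh_poly (\<lambda>t. c * f t)"
  by (intro little_oh_poly_mult little_oh_poly_const)

lemma little_oh_poly_minus: "little_oh_poly f \<Longrightarrow> little_oh_poly (\<lambda>t. - f t)"
  using little_oh_poly_cmult[of f "-1"] by simp

lemma little_oh_poly_power: "little_oh_poly f \<Longrightarrow> little_oh_poly (\<lambda>t. f t ^ n)"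
  by (induction n) (auto intro: little_oh_poly_mult little_oh_poly_const)

lemma little_oh_poly_sum:
  "(\<And>i. i \<in> A \<Longrightarrow> little_oh_poly (f i)) \<Longrightarrow> little_oh_poly (\<lambda>t. \<Sum>i\<in>A. f i t)"
  by (induction A rule: infinite_finite_induct)
     (auto intro: little_oh_poly_add little_oh_poly_const)


section \<open>The ring of Fermat reals\<close>

definition fermat_rel :: "(real \<Rightarrow> real) \<Rightarrow> (real \<Rightarrow> real) \<Rightarrow> bool" where
  "fermat_rel x y \<longleftrightarrow> little_oh_poly x \<and> little_oh_poly y \<and>
     (\<lambda>t. x t - y t) \<in> o[at_right 0](\<lambda>t. t)"

lemma part_equivp_fermat_rel: "part_equivp fermat_rel"
proof (rule part_equivpI)
  show "\<exists>x. fermat_rel x x"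
    by (auto simp: fermat_rel_def intro!: exI[of _ "\<lambda>_. 0"] little_oh_poly_const)
  show "symp fermat_rel"
  proof (rule sympI)
    fix x y assume "fermat_rel x y"
    then show "fermat_rel y x"
      using landau_o.small.uminus_in_iff[of "\<lambda>t. x t - y t" "at_right 0" "\<lambda>t. t"]
      by (auto simp: fermat_rel_def)
  qed
  show "transp fermat_rel"
  proof (rule transpI)
    fix x y z assume "fermat_rel x y" "fermat_rel y z"
    then show "fermat_rel x z"
      using sum_in_smallo(1)[of "\<lambda>t. x t - y t" "at_right 0" "\<lambda>t. t" "\<lambda>t. y t - z t"]
      by (auto simp: fermat_rel_def)
  qed
qed

quotient_type fermat = "real \<Rightarrow> real" / partial: fermat_rel
  by (rule part_equivp_fermat_rel)

lemma fermat_rel_cong: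
  "little_oh_poly x \<Longrightarrow> little_oh_poly y \<Longrightarrow> (\<And>t. t > 0 \<Longrightarrow> x t = y t) \<Longrightarrow> fermat_rel x y"
  unfolding fermat_rel_def
  by (auto intro!: landau_o.small.in_cong[THEN iffD2, OF _ zero_in_smallo]
           eventually_mono[OF eventually_pos_at_right_0])

instantiation fermat :: comm_ring_1
begin

lift_definition zero_fermat :: fermat is "\<lambda>_. 0"
  by (simp add: fermat_rel_def little_oh_poly_const)

lift_definition one_fermat :: fermat is "\<lambda>_. 1"
  by (simp add: fermat_rel_def little_oh_poly_const)

lift_definition plus_fermat :: "fermat \<Rightarrow> fermat \<Rightarrow> fermat" is "\<lambda>x y t. x t + y t"
proof -
  fix x x' y y' assume "fermat_rel x x'" "fermat_rel y y'"
  then show "fermat_rel (\<lambda>t. x t + y t) (\<lambda>t. x' t + y' t)"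
    using sum_in_smallo(1)[of "\<lambda>t. x t - x' t" "at_right 0" "\<lambda>t. t" "\<lambda>t. y t - y' t"]
    by (auto simp: fermat_rel_def algebra_simps intro: little_oh_poly_add)
qed

lift_definition uminus_fermat :: "fermat \<Rightarrow> fermat" is "\<lambda>x t. - x t"
proof -
  fix x x' assume "fermat_rel x x'"
  then show "fermat_rel (\<lambda>t. - x t) (\<lambda>t. - x' t)"
    using landau_o.small.uminus_in_iff[of "\<lambda>t. x t - x' t" "at_right 0" "\<lambda>t. t"]
    by (auto simp: fermat_rel_def intro: little_oh_poly_minus)
qed

definition minus_fermat :: "fermat \<Rightarrow> fermat \<Rightarrow> fermat" where
  "minus_fermat x y = x + - y"

lift_definition times_fermat :: "fermat \<Rightarrow> fermat \<Rightarrow> fermat" is "\<lambda>x y t. x t * y t"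
proof -
  fix x x' y y' assume xy: "fermat_rel x x'" "fermat_rel y y'"
  have "(\<lambda>t. (x t - x' t) * y t + x' t * (y t - y' t)) \<in> o[at_right 0](\<lambda>t. t)"
    using landau_o.small_big_mult[of "\<lambda>t. x t - x' t" "at_right 0" "\<lambda>t. t" y "\<lambda>_. 1"]
      landau_o.big_small_mult[of x' "at_right 0" "\<lambda>_. 1" "\<lambda>t. y t - y' t" "\<lambda>t. t"] xy
    by (intro sum_in_smallo) (auto simp: fermat_rel_def little_oh_poly_bigo)
  then show "fermat_rel (\<lambda>t. x t * y t) (\<lambda>t. x' t * y' t)"
    using xy by (auto simp: fermat_rel_def algebra_simps intro: little_oh_poly_mult)
qed

instance
proof
  fix a b c :: fermat
  show "a * b * c = a * (b * c)"
    by transfer (auto simp: fermat_rel_def algebra_simps intro!: little_oh_poly_mult)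
  show "a * b = b * a"
    by transfer (auto simp: fermat_rel_def algebra_simps intro!: little_oh_poly_mult)
  show "1 * a = a"
    by transfer (auto simp: fermat_rel_def)
  show "a + b + c = a + (b + c)"
    by transfer (auto simp: fermat_rel_def algebra_simps intro!: little_oh_poly_add)
  show "a + b = b + a"
    by transfer (auto simp: fermat_rel_def algebra_simps intro!: little_oh_poly_add)
  show "0 + a = a"
    by transfer (auto simp: fermat_rel_def)
  show "- a + a = 0"
    by transfer (auto simp: fermat_rel_def little_oh_poly_const)
  show "a - b = a + - b"
    by (simp add: minus_fermat_def)
  show "(a + b) * c = a * c + b * c"
    by transfer (auto simp: fermat_rel_def algebra_simps intro!: little_oh_poly_add little_oh_poly_mult)
  show "(0::fermat) \<noteq> 1"
  proof (transfer, rule notI)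
    assume "fermat_rel (\<lambda>_. 0) (\<lambda>_. 1)"
    then have "(\<lambda>_::real. - 1 :: real) \<in> o[at_right 0](\<lambda>t. t)"
      by (simp add: fermat_rel_def)
    then have "((\<lambda>t::real. - 1 / t) \<longlongrightarrow> 0) (at_right 0)"
      by (rule smalloD_tendsto)
    moreover have "filterlim (\<lambda>t::real. - 1 / t) at_infinity (at_right 0)"
      by real_asymp
    ultimately show False
      using not_tendsto_and_filterlim_at_infinity trivial_limit_at_right_real by blast
  qed
qed

end

instantiation fermat :: real_algebra_1
begin

lift_definition scaleR_fermat :: "real \<Rightarrow> fermat \<Rightarrow> fermat" is "\<lambda>r x t. r * x t"
proof -
  fix r x x' assume "fermat_rel x x'"
  then show "fermat_rel (\<lambda>t. r * x t) (\<lambda>t. r * x' t)"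
    using landau_o.big_small_mult[of "\<lambda>_. r" "at_right 0" "\<lambda>_. 1" "\<lambda>t. x t - x' t" "\<lambda>t. t"]
    by (auto simp: fermat_rel_def right_diff_distrib[symmetric] intro: little_oh_poly_cmult)
qed

instance
  by (standard; transfer)
     (auto simp: fermat_rel_def algebra_simps
           intro!: little_oh_poly_add little_oh_poly_mult little_oh_poly_const)

end

lemma of_real_fermat: "(of_real r :: fermat) = abs_fermat (\<lambda>_. r)"
  unfolding of_real_def one_fermat_def
  by (subst scaleR_fermat.abs_eq) (auto simp: fermat_rel_def little_oh_poly_const)

lemma abs_fermat_eq_iff:
  assumes "little_oh_poly f" "little_oh_poly g"
  shows "abs_fermat f = abs_fermat g \<longleftrightarrow> (\<lambda>t. f t - g t) \<in> o[at_right 0](\<lambda>t. t)"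
  using Quotient3_rel[OF Quotient3_fermat, of f g] assms by (auto simp: fermat_rel_def)

lemma abs_fermat_add:
  "little_oh_poly f \<Longrightarrow> little_oh_poly g \<Longrightarrow> abs_fermat f + abs_fermat g = abs_fermat (\<lambda>t. f t + g t)"
  by (subst plus_fermat.abs_eq) (auto simp: fermat_rel_def)

lemma abs_fermat_scaleR:
  "little_oh_poly f \<Longrightarrow> r *\<^sub>R abs_fermat f = abs_fermat (\<lambda>t. r * f t)"
  by (subst scaleR_fermat.abs_eq) (auto simp: fermat_rel_def)

lemma fermat_cases:
  obtains f where "little_oh_poly f" "x = abs_fermat f"
proof -
  have "fermat_rel (rep_fermat x) (rep_fermat x)" "abs_fermat (rep_fermat x) = x"
    using Quotient3_rep_reflp[OF Quotient3_fermat] Quotient3_abs_rep[OF Quotient3_fermat] by auto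
  then show ?thesis
    using that[of "rep_fermat x"] by (auto simp: fermat_rel_def)
qed


section \<open>Decomposition and order\<close>

definition dt :: "real \<Rightarrow> fermat" where
  "dt a = abs_fermat (\<lambda>t. if a > 0 then t powr (1 / a) else 0)"

text \<open>
  A list entry \<open>(a, w)\<close> stands for the infinitesimal summand \<open>a *\<^sub>R dt w\<close>.
\<close>

definition is_decomposition :: "fermat \<Rightarrow> real \<Rightarrow> (real \<times> real) list \<Rightarrow> bool" where
  "is_decomposition x r cs \<longleftrightarrow>
     x = of_real r + (\<Sum>(a, w)\<leftarrow>cs. a *\<^sub>R dt w) \<and>
     (\<forall>(a, w)\<in>set cs. a \<noteq> 0 \<and> w \<ge> 1) \<and>
     sorted_wrt (>) (map snd cs)"

definition gterms :: "(real \<times> real) list \<Rightarrow> (real \<times> real) list" where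
  "gterms cs = map (\<lambda>(a, w). (a, 1 / w)) cs"

lemma little_oh_poly_gterms:
  "(\<forall>(a, w)\<in>set cs. w \<ge> 1) \<Longrightarrow> little_oh_poly (gpoly (gterms cs))"
  by (intro little_oh_poly_gpoly) (auto simp: gterms_def split: prod.splits dest!: bspec)

lemma sum_list_dt:
  assumes "\<forall>(a, w)\<in>set cs. w \<ge> 1"
  shows "(\<Sum>(a, w)\<leftarrow>cs. a *\<^sub>R dt w) = abs_fermat (gpoly (gterms cs))"
  using assms
proof (induction cs)
  case Nil
  show ?case by (simp add: zero_fermat_def gterms_def gpoly_def[abs_def])
next
  case (Cons c cs)
  obtain a w where c: "c = (a, w)" by (cases c)
  have w: "w \<ge> 1" and cs: "\<forall>(a, w)\<in>set cs. w \<ge> 1"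
    using Cons.prems by (auto simp: c)
  have "(\<Sum>(a, w)\<leftarrow>c # cs. a *\<^sub>R dt w) = a *\<^sub>R dt w + abs_fermat (gpoly (gterms cs))"
    using Cons by (simp add: c)
  also have "a *\<^sub>R dt w = abs_fermat (\<lambda>t. a * t powr (1 / w))"
    using w little_oh_poly_monom[of "1 / w" 1] by (simp add: dt_def abs_fermat_scaleR)
  also have "\<dots> + abs_fermat (gpoly (gterms cs)) = abs_fermat (\<lambda>t. a * t powr (1 / w) + gpoly (gterms cs) t)"
    using w by (intro abs_fermat_add little_oh_poly_monom little_oh_poly_gterms cs) auto
  also have "(\<lambda>t. a * t powr (1 / w) + gpoly (gterms cs) t) = gpoly (gterms (c # cs))"
    by (simp add: gterms_def c fun_eq_iff)
  finally show ?case .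
qed

lemma is_decomposition_abs_iff:
  assumes "little_oh_poly f"
  shows "is_decomposition (abs_fermat f) r cs \<longleftrightarrow>
     (\<lambda>t. f t - (r + gpoly (gterms cs) t)) \<in> o[at_right 0](\<lambda>t. t) \<and>
     (\<forall>(a, w)\<in>set cs. a \<noteq> 0 \<and> w \<ge> 1) \<and> sorted_wrt (>) (map snd cs)"
proof -
  have "abs_fermat f = of_real r + (\<Sum>(a, w)\<leftarrow>cs. a *\<^sub>R dt w) \<longleftrightarrow>
     (\<lambda>t. f t - (r + gpoly (gterms cs) t)) \<in> o[at_right 0](\<lambda>t. t)"
    if *: "\<forall>(a, w)\<in>set cs. a \<noteq> 0 \<and> w \<ge> 1"
  proof -
    have cs: "\<forall>(a, w)\<in>set cs. w \<ge> 1" using * by auto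
    show ?thesis
      using cs assms
      by (simp add: sum_list_dt of_real_fermat abs_fermat_add abs_fermat_eq_iff
            little_oh_poly_const little_oh_poly_gterms little_oh_poly_add)
  qed
  then show ?thesis
    unfolding is_decomposition_def by blast
qed

lemma powr_bigo_powr_at_right_0:
  "b \<le> a \<Longrightarrow> (\<lambda>t::real. t powr a) \<in> O[at_right 0](\<lambda>t. t powr b)"
proof (rule bigoI[of _ 1])
  assume "b \<le> a"
  have "eventually (\<lambda>t::real. t \<in> {0<..<1}) (at_right 0)"
    by (rule eventually_at_right_real) simp
  then show "eventually (\<lambda>t::real. norm (t powr a) \<le> 1 * norm (t powr b)) (at_right 0)"
    by eventually_elim (use \<open>b \<le> a\<close> in \<open>auto intro: powr_mono'\<close>)
qed

lemma powr_smallo_powr_at_right_0: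
  "b < a \<Longrightarrow> (\<lambda>t::real. t powr a) \<in> o[at_right 0](\<lambda>t. t powr b)"
  by real_asymp

lemma ident_bigo_powr_at_right_0:
  assumes "b \<le> 1"
  shows "(\<lambda>t::real. t) \<in> O[at_right 0](\<lambda>t. t powr b)"
proof -
  have "eventually (\<lambda>t::real. t = t powr 1) (at_right 0)"
    using eventually_pos_at_right_0 by eventually_elim simp
  then show ?thesis
    using powr_bigo_powr_at_right_0[OF assms] by (subst landau_o.big.in_cong)
qed

lemma gpoly_smallo:
  "\<forall>(b, \<beta>)\<in>set cs. \<beta> > \<alpha> \<Longrightarrow> gpoly cs \<in> o[at_right 0](\<lambda>t. t powr \<alpha>)"
proof (induction cs)
  case Nil
  show ?case by (simp add: gpoly_def[abs_def])
next
  case (Cons c cs)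
  obtain b \<beta> where c: "c = (b, \<beta>)" by (cases c)
  have "(\<lambda>t. b * t powr \<beta> + gpoly cs t) \<in> o[at_right 0](\<lambda>t. t powr \<alpha>)"
    using Cons powr_smallo_powr_at_right_0[of \<alpha> \<beta>] by (intro sum_in_smallo) (auto simp: c)
  then show ?case by (simp add: c gpoly_def[abs_def])
qed

lemma cmult_powr_smallo_imp_zero:
  assumes "(\<lambda>t::real. a * t powr \<alpha>) \<in> o[at_right 0](\<lambda>t. t powr \<alpha>)"
  shows "a = 0"
proof (rule ccontr)
  assume "a \<noteq> 0"
  then have "(\<lambda>t::real. t powr \<alpha>) \<in> o[at_right 0](\<lambda>t. t powr \<alpha>)"
    using assms by simp
  then have "eventually (\<lambda>t::real. t powr \<alpha> = 0) (at_right 0)"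
    by (simp add: landau_o.small_refl_iff)
  with eventually_pos_at_right_0 have "eventually (\<lambda>t::real. False) (at_right 0)"
    by eventually_elim simp
  then show False by simp
qed

lemma gpoly_unique:
  assumes "(\<lambda>t. gpoly cs t - gpoly ds t) \<in> o[at_right 0](\<lambda>t. t)"
    and "\<forall>(a, \<alpha>)\<in>set cs. a \<noteq> 0 \<and> \<alpha> \<le> 1" "\<forall>(a, \<alpha>)\<in>set ds. a \<noteq> 0 \<and> \<alpha> \<le> 1"
    and "sorted_wrt (<) (map snd cs)" "sorted_wrt (<) (map snd ds)"
  shows "cs = ds"
proof -
  have lead: "a = 0"
    if o: "(\<lambda>t. a * t powr \<alpha> + (gpoly cs t - gpoly ds t)) \<in> o[at_right 0](\<lambda>t. t)"
      and "\<alpha> \<le> 1" "\<forall>(b, \<beta>)\<in>set cs. \<beta> > \<alpha>" "\<forall>(b, \<beta>)\<in>set ds. \<beta> > \<alpha>" for a \<alpha> cs ds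
  proof (rule cmult_powr_smallo_imp_zero)
    have "(\<lambda>t. (a * t powr \<alpha> + (gpoly cs t - gpoly ds t)) - (gpoly cs t - gpoly ds t))
            \<in> o[at_right 0](\<lambda>t. t powr \<alpha>)"
      by (rule sum_in_smallo(2)[OF _ sum_in_smallo(2)])
         (rule landau_o.small_big_trans[OF o ident_bigo_powr_at_right_0] gpoly_smallo that(2-))+
    then show "(\<lambda>t. a * t powr \<alpha>) \<in> o[at_right 0](\<lambda>t. t powr \<alpha>)" by simp
  qed
  show ?thesis
    using assms
  proof (induction cs arbitrary: ds)
    case Nil
    show ?case
    proof (cases ds)
      case (Cons d ds')
      obtain b \<beta> where d: "d = (b, \<beta>)" by (cases d)
      have "- b = 0"
        by (rule lead[of _ \<beta> "[]" ds']) (use Nil Cons in \<open>auto simp: d algebra_simps\<close>)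
      then show ?thesis using Nil Cons by (auto simp: d)
    qed simp
  next
    case (Cons c cs)
    obtain a \<alpha> where c: "c = (a, \<alpha>)" by (cases c)
    show ?case
    proof (cases ds)
      case Nil
      have "a = 0"
        by (rule lead[of _ \<alpha> cs "[]"]) (use Nil Cons in \<open>auto simp: c algebra_simps\<close>)
      then show ?thesis using Cons by (auto simp: c)
    next
      case ds: (Cons d ds')
      obtain b \<beta> where d: "d = (b, \<beta>)" by (cases d)
      consider "\<alpha> < \<beta>" | "\<beta> < \<alpha>" | "\<alpha> = \<beta>" by linarith
      then show ?thesis
      proof cases
        case 1
        have "a = 0"
          by (rule lead[of _ \<alpha> cs ds]) (use 1 Cons.prems in \<open>force simp: ds c d algebra_simps\<close>)+
        then show ?thesis using Cons.prems by (auto simp: c)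
      next
        case 2
        have "- b = 0"
          by (rule lead[of _ \<beta> "c # cs" ds']) (use 2 Cons.prems in \<open>force simp: ds c d algebra_simps\<close>)+
        then show ?thesis using Cons.prems by (auto simp: ds d)
      next
        case 3
        have "a - b = 0"
          by (rule lead[of _ \<alpha> cs ds']) (use 3 Cons.prems in \<open>auto simp: ds c d algebra_simps\<close>)
        moreover from this have "cs = ds'"
          using 3 Cons.prems by (intro Cons.IH) (auto simp: ds c d)
        ultimately show ?thesis using 3 by (simp add: c d ds)
      qed
    qed
  qed
qed

lemma gterms_tendsto_0:
  assumes "\<forall>(a, w)\<in>set cs. a \<noteq> 0 \<and> w \<ge> 1"
  shows "(gpoly (gterms cs) \<longlongrightarrow> 0) (at_right 0)"
proof -
  have "gpoly (gterms cs) \<in> o[at_right 0](\<lambda>t. t powr 0)"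
    using assms by (intro gpoly_smallo) (fastforce simp: gterms_def)
  moreover have "eventually (\<lambda>t::real. t powr 0 = 1) (at_right 0)"
    using eventually_pos_at_right_0 by eventually_elim simp
  ultimately have "gpoly (gterms cs) \<in> o[at_right 0](\<lambda>_. 1)"
    by (subst (asm) landau_o.small.cong)
  from smalloD_tendsto[OF this] show ?thesis by simp
qed

lemma is_decomposition_tendsto:
  assumes "little_oh_poly f" "is_decomposition (abs_fermat f) r cs"
  shows "(f \<longlongrightarrow> r) (at_right 0)"
proof -
  have "(\<lambda>t. f t - (r + gpoly (gterms cs) t)) \<in> o[at_right 0](\<lambda>t. t)"
    and cs: "\<forall>(a, w)\<in>set cs. a \<noteq> 0 \<and> w \<ge> 1"
    using assms by (auto simp: is_decomposition_abs_iff)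
  moreover have "(\<lambda>t::real. t) \<in> o[at_right 0](\<lambda>_. 1)" by real_asymp
  ultimately have "(\<lambda>t. f t - (r + gpoly (gterms cs) t)) \<in> o[at_right 0](\<lambda>_. 1)"
    using landau_o.small_trans by blast
  from smalloD_tendsto[OF this]
  have "((\<lambda>t. f t - (r + gpoly (gterms cs) t)) \<longlongrightarrow> 0) (at_right 0)" by simp
  from tendsto_add[OF this tendsto_add[OF tendsto_const[of r] gterms_tendsto_0[OF cs]]]
  show ?thesis by simp
qed

lemma is_decomposition_unique:
  assumes "is_decomposition x r cs" "is_decomposition x r' ds"
  shows "r = r' \<and> cs = ds"
proof -
  obtain f where f: "little_oh_poly f" "x = abs_fermat f" by (rule fermat_cases)
  have r: "r = r'"
    using is_decomposition_tendsto[OF f(1)] assms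
    by (intro tendsto_unique[of "at_right 0" f]) (auto simp: f(2))
  have cs: "(\<lambda>t. f t - (r + gpoly (gterms cs) t)) \<in> o[at_right 0](\<lambda>t. t)"
    "\<forall>(a, w)\<in>set cs. a \<noteq> 0 \<and> w \<ge> 1" "sorted_wrt (>) (map snd cs)"
    using assms(1) by (auto simp: f is_decomposition_abs_iff)
  have ds: "(\<lambda>t. f t - (r + gpoly (gterms ds) t)) \<in> o[at_right 0](\<lambda>t. t)"
    "\<forall>(a, w)\<in>set ds. a \<noteq> 0 \<and> w \<ge> 1" "sorted_wrt (>) (map snd ds)"
    using assms(2) r by (auto simp: f is_decomposition_abs_iff)
  have sorted: "sorted_wrt (<) (map snd (gterms es))"
    if "\<forall>(a, w)\<in>set es. a \<noteq> 0 \<and> w \<ge> 1" "sorted_wrt (>) (map snd es)" for es :: "(real \<times> real) list"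
    using that by (induction es) (fastforce simp: gterms_def frac_less2)+
  have "(\<lambda>t. (f t - (r + gpoly (gterms ds) t)) - (f t - (r + gpoly (gterms cs) t))) \<in> o[at_right 0](\<lambda>t. t)"
    using ds(1) cs(1) by (rule sum_in_smallo)
  then have "gterms cs = gterms ds"
    using cs(2,3) ds(2,3)
    by (intro gpoly_unique sorted) (auto simp: gterms_def)
  moreover have "inj (\<lambda>(a, w). (a :: real, 1 / w :: real))"
    by (auto simp: inj_def)
  ultimately show ?thesis
    using r by (simp add: gterms_def inj_map_eq_map)
qed

lemma gpoly_collect:
  assumes "\<forall>(a, \<alpha>)\<in>set cs. \<alpha> \<ge> 0"
  shows "\<exists>r S c. finite S \<and> S \<subseteq> {0<..} \<and> (\<forall>t>0. gpoly cs t = r + (\<Sum>\<alpha>\<in>S. c \<alpha> * t powr \<alpha>))"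
  using assms
proof (induction cs)
  case Nil
  show ?case by (intro exI[of _ 0] exI[of _ "{}"]) simp
next
  case (Cons d ds)
  obtain b \<beta> where d: "d = (b, \<beta>)" by (cases d)
  obtain r S c where S: "finite S" "S \<subseteq> {0<..}"
    and eq: "\<And>t. t > 0 \<Longrightarrow> gpoly ds t = r + (\<Sum>\<alpha>\<in>S. c \<alpha> * t powr \<alpha>)"
    using Cons by auto
  show ?case
  proof (cases "\<beta> = 0")
    case True
    then show ?thesis
      using S eq by (intro exI[of _ "b + r"] exI[of _ S] exI[of _ c]) (auto simp: d)
  next
    case False
    define c' where "c' = (\<lambda>\<alpha>. if \<alpha> = \<beta> then b + (if \<beta> \<in> S then c \<beta> else 0) else c \<alpha>)"
    have "gpoly (d # ds) t = r + (\<Sum>\<alpha>\<in>insert \<beta> S. c' \<alpha> * t powr \<alpha>)" if "t > 0" for t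
    proof -
      have "(\<Sum>\<alpha>\<in>S - {\<beta>}. c' \<alpha> * t powr \<alpha>) = (\<Sum>\<alpha>\<in>S - {\<beta>}. c \<alpha> * t powr \<alpha>)"
        by (intro sum.cong) (auto simp: c'_def)
      then show ?thesis
        using S(1) eq[OF that]
        by (cases "\<beta> \<in> S")
           (auto simp: d sum.insert_remove sum.remove[of S \<beta>] c'_def algebra_simps)
    qed
    then show ?thesis
      using S False Cons.prems
      by (intro exI[of _ r] exI[of _ "insert \<beta> S"] exI[of _ c']) (auto simp: d)
  qed
qed

lemma is_decomposition_exists: "\<exists>r cs. is_decomposition x r cs"
proof -
  obtain f where f: "little_oh_poly f" "x = abs_fermat f" by (rule fermat_cases)
  obtain ds where ds: "\<forall>(a, \<alpha>)\<in>set ds. \<alpha> \<ge> 0" "(\<lambda>t. f t - gpoly ds t) \<in> o[at_right 0](\<lambda>t. t)"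
    using f(1) unfolding little_oh_poly_iff_gpoly by blast
  obtain r S c where S: "finite S" "S \<subseteq> {0<..}"
    and eq: "\<And>t. t > 0 \<Longrightarrow> gpoly ds t = r + (\<Sum>\<alpha>\<in>S. c \<alpha> * t powr \<alpha>)"
    using gpoly_collect[OF ds(1)] by blast
  define T where "T = {\<alpha>\<in>S. \<alpha> \<le> 1 \<and> c \<alpha> \<noteq> 0}"
  define cs where "cs = map (\<lambda>\<alpha>. (c \<alpha>, 1 / \<alpha>)) (sorted_list_of_set T)"
  have T: "finite T" "T \<subseteq> S" "T \<subseteq> {0<..1}"
    using S by (auto simp: T_def)
  have "map snd cs = map (\<lambda>\<alpha>. 1 / \<alpha>) (sorted_list_of_set T)"
    by (simp add: cs_def)
  moreover have "sorted_wrt (>) (map (\<lambda>\<alpha>::real. 1 / \<alpha>) (sorted_list_of_set T))"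
    unfolding sorted_wrt_map
    by (rule sorted_wrt_mono_rel[OF _ strict_sorted_list_of_set])
       (use T in \<open>auto simp: frac_less2\<close>)
  ultimately have sorted: "sorted_wrt (>) (map snd cs)" by simp
  have set: "\<forall>(a, w)\<in>set cs. a \<noteq> 0 \<and> w \<ge> 1"
    using T S by (auto simp: cs_def T_def)
  have gp: "gpoly (gterms cs) t = (\<Sum>\<alpha>\<in>T. c \<alpha> * t powr \<alpha>)" for t
  proof -
    have "gpoly (gterms cs) t = (\<Sum>\<alpha>\<leftarrow>sorted_list_of_set T. c \<alpha> * t powr \<alpha>)"
      by (simp add: gpoly_def gterms_def cs_def comp_def)
    also have "\<dots> = (\<Sum>\<alpha>\<in>T. c \<alpha> * t powr \<alpha>)"
      using T(1) by (subst sum_list_distinct_conv_sum_set) auto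
    finally show ?thesis .
  qed
  have "(\<lambda>t. \<Sum>\<alpha>\<in>S - T. c \<alpha> * t powr \<alpha>) \<in> o[at_right 0](\<lambda>t. t)"
  proof (rule big_sum_in_smallo)
    fix \<alpha> assume \<alpha>: "\<alpha> \<in> S - T"
    show "(\<lambda>t. c \<alpha> * t powr \<alpha>) \<in> o[at_right 0](\<lambda>t. t)"
    proof (cases "c \<alpha> = 0")
      case False
      then have "\<alpha> > 1" using \<alpha> by (auto simp: T_def)
      then have "(\<lambda>t. t powr \<alpha>) \<in> o[at_right 0](\<lambda>t::real. t)" by real_asymp
      then show ?thesis by simp
    qed simp
  qed
  then have "(\<lambda>t. (f t - gpoly ds t) + (\<Sum>\<alpha>\<in>S - T. c \<alpha> * t powr \<alpha>)) \<in> o[at_right 0](\<lambda>t. t)"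
    by (rule sum_in_smallo(1)[OF ds(2)])
  moreover have "eventually (\<lambda>t. f t - (r + gpoly (gterms cs) t) =
      (f t - gpoly ds t) + (\<Sum>\<alpha>\<in>S - T. c \<alpha> * t powr \<alpha>)) (at_right 0)"
    using eventually_pos_at_right_0
    by eventually_elim (simp add: eq gp sum_diff[OF S(1) T(2)])
  ultimately have "(\<lambda>t. f t - (r + gpoly (gterms cs) t)) \<in> o[at_right 0](\<lambda>t. t)"
    by (subst landau_o.small.in_cong)
  then have "is_decomposition x r cs"
    using set sorted by (simp add: f is_decomposition_abs_iff)
  then show ?thesis by blast
qed

definition std_part :: "fermat \<Rightarrow> real" where
  "std_part x = (THE r. \<exists>cs. is_decomposition x r cs)"

definition inf_terms :: "fermat \<Rightarrow> (real \<times> real) list" where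
  "inf_terms x = (THE cs. \<exists>r. is_decomposition x r cs)"

lemma is_decomposition_inf_terms: "is_decomposition x (std_part x) (inf_terms x)"
proof -
  obtain r cs where *: "is_decomposition x r cs" using is_decomposition_exists by blast
  then have "std_part x = r" "inf_terms x = cs"
    unfolding std_part_def inf_terms_def using is_decomposition_unique by blast+
  with * show ?thesis by simp
qed

lemma std_part_tendsto:
  "little_oh_poly f \<Longrightarrow> (f \<longlongrightarrow> std_part (abs_fermat f)) (at_right 0)"
  using is_decomposition_tendsto is_decomposition_inf_terms by blast

text \<open>The summands are numbered from 1, hence the index shift.\<close>

definition num_terms :: "fermat \<Rightarrow> nat" where
  "num_terms x = length (inf_terms x)"

definition coef :: "fermat \<Rightarrow> nat \<Rightarrow> real" where
  "coef x i = fst (inf_terms x ! (i - 1))"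

definition omega :: "fermat \<Rightarrow> nat \<Rightarrow> real" where
  "omega x i = snd (inf_terms x ! (i - 1))"

lemma fermat_decomposition:
  "x = of_real (std_part x) + (\<Sum>i=1..num_terms x. coef x i *\<^sub>R dt (omega x i))"
proof -
  have "(\<Sum>(a, w)\<leftarrow>inf_terms x. a *\<^sub>R dt w) = (\<Sum>i=1..num_terms x. coef x i *\<^sub>R dt (omega x i))"
    unfolding sum_list_sum_nth num_terms_def coef_def omega_def
    by (simp add: case_prod_beta)
       (rule sum.reindex_bij_witness[of _ "\<lambda>i. i - 1" Suc], auto)
  then show ?thesis
    using is_decomposition_inf_terms[of x] by (simp add: is_decomposition_def)
qed

definition fermat_pos :: "fermat \<Rightarrow> bool" where
  "fermat_pos x \<longleftrightarrow> std_part x > 0 \<or> (std_part x = 0 \<and> x \<noteq> 0 \<and> coef x 1 > 0)"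


section \<open>Powers\<close>

text \<open>
  All orders \<open>omega x i\<close> are finite, and \<open>oominus\<close> is only needed for \<open>a < b\<close>; then both operations
  have finite positive values and the conventions for infinite arguments play no role.
\<close>

definition ooplus :: "real \<Rightarrow> real \<Rightarrow> real" (infixl "\<oplus>\<^sub>o" 65) where
  "a \<oplus>\<^sub>o b = inverse (1 / a + 1 / b)"

definition oominus :: "real \<Rightarrow> real \<Rightarrow> real" (infixl "\<ominus>\<^sub>o" 65) where
  "a \<ominus>\<^sub>o b = inverse (1 / a - 1 / b)"

text \<open>
  For \<open>std_part y > 0\<close> the choice of the representative of \<open>y\<close> is immaterial, see
  \<open>inv_powr_abs\<close> below.
\<close>

definition inv_powr :: "fermat \<Rightarrow> real \<Rightarrow> fermat" where
  "inv_powr y p = abs_fermat (\<lambda>t. rep_fermat y t powr p)"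

text \<open>
  The value is meaningful if \<open>std_part x > 0\<close>, or if \<open>x\<close> is a positive infinitesimal and \<open>p > 0\<close>.
\<close>

definition fermat_powr :: "fermat \<Rightarrow> real \<Rightarrow> fermat" where
  "fermat_powr x p =
     (if std_part x > 0 then inv_powr x p
      else (coef x 1 powr p) *\<^sub>R dt (omega x 1 / p) *
           inv_powr (1 + (\<Sum>i=2..num_terms x.
             (coef x i / coef x 1) *\<^sub>R dt (omega x i \<ominus>\<^sub>o omega x 1))) p)"

lemma one_plus_powr_bigo:
  fixes p :: real
  shows "(\<lambda>z. (1 + z) powr p - (\<Sum>k<n. (p gchoose k) * z ^ k)) \<in> O[nhds 0](\<lambda>z. z ^ n)"
proof -
  have "summable (\<lambda>k. (p gchoose k) * (3/4) ^ k)"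
    using gen_binomial_real[of "3/4" p] by (simp add: sums_iff)
  then have "summable (\<lambda>k. norm ((p gchoose k) * (1/2) ^ k))"
    by (rule powser_insidea) simp
  then have "summable (\<lambda>k. norm ((p gchoose (k + n)) * (1/2) ^ (k + n)))"
    by (subst summable_iff_shift)
  then have "summable (\<lambda>k. 2 ^ n * norm ((p gchoose (k + n)) * (1/2) ^ (k + n)))"
    by (rule summable_mult)
  also have "(\<lambda>k. 2 ^ n * norm ((p gchoose (k + n)) * (1/2) ^ (k + n))) =
             (\<lambda>k. norm ((p gchoose (k + n)) * (1/2) ^ k))"
    by (simp add: fun_eq_iff abs_mult power_add power_divide)
  finally have summ: "summable (\<lambda>k. norm ((p gchoose (k + n)) * (1/2) ^ k))" .
  define C where "C = (\<Sum>k. norm ((p gchoose (k + n)) * (1/2) ^ k))"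
  have bound: "norm ((1 + z) powr p - (\<Sum>k<n. (p gchoose k) * z ^ k)) \<le> C * norm (z ^ n)"
    if z: "\<bar>z\<bar> < 1/2" for z
  proof -
    have sums: "(\<lambda>k. (p gchoose k) * z ^ k) sums (1 + z) powr p"
      using gen_binomial_real[of z p] z by simp
    have le: "norm ((p gchoose (k + n)) * z ^ k) \<le> norm ((p gchoose (k + n)) * (1/2) ^ k)" for k
      using z power_mono[of "\<bar>z\<bar>" "1/2" k] by (auto simp: abs_mult power_abs intro!: mult_left_mono)
    have summ': "summable (\<lambda>k. norm ((p gchoose (k + n)) * z ^ k))"
      by (rule summable_comparison_test'[OF summ, of 0]) (use le in simp)
    have "(1 + z) powr p - (\<Sum>k<n. (p gchoose k) * z ^ k) = (\<Sum>k. (p gchoose (k + n)) * z ^ (k + n))"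
      using suminf_minus_initial_segment[OF sums_summable[OF sums], of n] sums by (simp add: sums_iff)
    also have "\<dots> = (\<Sum>k. ((p gchoose (k + n)) * z ^ k) * z ^ n)"
      by (simp add: power_add mult.assoc)
    also have "\<dots> = (\<Sum>k. (p gchoose (k + n)) * z ^ k) * z ^ n"
      by (rule suminf_mult2[symmetric, OF summable_norm_cancel[OF summ']])
    also have "norm \<dots> = norm (\<Sum>k. (p gchoose (k + n)) * z ^ k) * norm (z ^ n)"
      by (rule norm_mult)
    also have "norm (\<Sum>k. (p gchoose (k + n)) * z ^ k) \<le> (\<Sum>k. norm ((p gchoose (k + n)) * z ^ k))"
      by (rule summable_norm[OF summ'])
    also have "\<dots> \<le> C"
      unfolding C_def by (rule suminf_le[OF le summ' summ])
    finally show ?thesis by (simp add: mult_right_mono)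
  qed
  have "eventually (\<lambda>z::real. z \<in> ball 0 (1/2)) (nhds 0)"
    by (intro eventually_nhds_in_open) auto
  then have "eventually (\<lambda>z. norm ((1 + z) powr p - (\<Sum>k<n. (p gchoose k) * z ^ k)) \<le> C * norm (z ^ n)) (nhds 0)"
    by eventually_elim (rule bound, simp)
  then show ?thesis by (rule bigoI)
qed

lemma little_oh_poly_one_plus_powr:
  assumes "little_oh_poly h" "(h \<longlongrightarrow> 0) (at_right 0)"
  shows "little_oh_poly (\<lambda>t. (1 + h t) powr p)"
proof -
  obtain r \<epsilon> where r: "\<epsilon> > 0" "(\<lambda>t. h t - r) \<in> O[at_right 0](\<lambda>t. t powr \<epsilon>)"
    using little_oh_poly_expand[OF assms(1)] .
  have "(\<lambda>t. h t - r) \<in> o[at_right 0](\<lambda>_. 1)"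
    using powr_tendsto_0_at_right[OF r(1)]
    by (intro landau_o.big_small_trans[OF r(2)] smalloI_tendsto) auto
  from smalloD_tendsto[OF this] have "(h \<longlongrightarrow> r) (at_right 0)"
    by (simp add: LIM_zero_iff)
  with assms(2) have "r = 0"
    by (intro tendsto_unique[of "at_right 0" h]) auto
  with r have h: "h \<in> O[at_right 0](\<lambda>t. t powr \<epsilon>)" by simp
  obtain n :: nat where n: "1 / \<epsilon> < n" using reals_Archimedean2 by blast
  have "(\<lambda>t. (1 + h t) powr p - (\<Sum>k<n. (p gchoose k) * h t ^ k)) \<in> O[at_right 0](\<lambda>t. h t ^ n)"
    using landau_o.big.compose[OF one_plus_powr_bigo assms(2)] .
  also have "(\<lambda>t. h t ^ n) \<in> O[at_right 0](\<lambda>t. (t powr \<epsilon>) ^ n)"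
    using h by (rule landau_o.big_power)
  also have "(\<lambda>t::real. (t powr \<epsilon>) ^ n) \<in> o[at_right 0](\<lambda>t. t)"
  proof -
    have "(\<lambda>t::real. t powr (\<epsilon> * n)) \<in> o[at_right 0](\<lambda>t. t powr 1)"
      using n r(1) by (intro powr_smallo_powr_at_right_0) (simp add: field_simps)
    moreover have "eventually (\<lambda>t::real. (t powr \<epsilon>) ^ n = t powr (\<epsilon> * n)) (at_right 0)"
      using eventually_pos_at_right_0 by eventually_elim (simp add: powr_powr flip: powr_realpow)
    moreover have "eventually (\<lambda>t::real. t = t powr 1) (at_right 0)"
      using eventually_pos_at_right_0 by eventually_elim simp
    ultimately show ?thesis
      by (simp only: landau_o.small.in_cong landau_o.small.cong)
  qed
  finally show ?thesis
    by (rule little_oh_poly_cong[rotated])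
       (intro little_oh_poly_sum little_oh_poly_cmult little_oh_poly_power assms(1))
qed

lemma little_oh_poly_powr:
  assumes "little_oh_poly f" "(f \<longlongrightarrow> r) (at_right 0)" "r > 0"
  shows "little_oh_poly (\<lambda>t. f t powr p)"
proof -
  define h where "h = (\<lambda>t. f t / r - 1)"
  have lop: "little_oh_poly (\<lambda>t. inverse r * f t + (- 1))"
    by (intro little_oh_poly_add little_oh_poly_cmult little_oh_poly_const assms(1))
  then have "little_oh_poly h"
    by (simp add: h_def divide_inverse mult.commute)
  moreover have "(h \<longlongrightarrow> r / r - 1) (at_right 0)"
    unfolding h_def using assms by (intro tendsto_intros) auto
  ultimately have "little_oh_poly (\<lambda>t. r powr p * (1 + h t) powr p)"
    using assms(3) by (intro little_oh_poly_cmult little_oh_poly_one_plus_powr) auto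
  moreover have "eventually (\<lambda>t. f t > 0) (at_right 0)"
    using order_tendstoD(1)[OF assms(2,3)] .
  then have "eventually (\<lambda>t. f t powr p - r powr p * (1 + h t) powr p = 0) (at_right 0)"
    by eventually_elim (use assms(3) in \<open>simp add: h_def powr_divide\<close>)
  then have "(\<lambda>t. f t powr p - r powr p * (1 + h t) powr p) \<in> o[at_right 0](\<lambda>t. t)"
    by (rule landau_o.small.in_cong[THEN iffD2, OF _ zero_in_smallo])
  ultimately show ?thesis
    by (rule little_oh_poly_cong)
qed

lemma powr_diff_smallo:
  fixes f g :: "real \<Rightarrow> real"
  assumes "(f \<longlongrightarrow> r) (at_right 0)" "(g \<longlongrightarrow> r) (at_right 0)" "r > 0"
    and "(\<lambda>t. f t - g t) \<in> o[at_right 0](\<lambda>t. t)"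
  shows "(\<lambda>t. f t powr p - g t powr p) \<in> o[at_right 0](\<lambda>t. t)"
proof -
  define h where "h = (\<lambda>t. f t / g t - 1)"
  have pos: "eventually (\<lambda>t. f t > 0) (at_right 0)" "eventually (\<lambda>t. g t > 0) (at_right 0)"
    using order_tendstoD(1)[OF _ assms(3)] assms(1,2) by auto
  have "(h \<longlongrightarrow> r / r - 1) (at_right 0)"
    unfolding h_def using assms by (intro tendsto_intros) auto
  then have h0: "(h \<longlongrightarrow> 0) (at_right 0)" using assms(3) by simp
  have "((\<lambda>t. inverse (g t)) \<longlongrightarrow> inverse r) (at_right 0)"
    using assms by (intro tendsto_intros) auto
  then have "(\<lambda>t. inverse (g t)) \<in> O[at_right 0](\<lambda>_. 1)"
    by (intro bigoI_tendsto[of _ _ "inverse r"]) auto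
  from landau_o.small_big_mult[OF assms(4) this]
  have "(\<lambda>t. (f t - g t) * inverse (g t)) \<in> o[at_right 0](\<lambda>t. t)" by simp
  moreover have "eventually (\<lambda>t. h t = (f t - g t) * inverse (g t)) (at_right 0)"
    using pos(2) by eventually_elim (simp add: h_def field_simps)
  ultimately have h: "h \<in> o[at_right 0](\<lambda>t. t)"
    by (subst landau_o.small.in_cong)
  have "(\<lambda>t. (1 + h t) powr p - 1) \<in> O[at_right 0](\<lambda>t. h t)"
    using landau_o.big.compose[OF one_plus_powr_bigo[of p 1] h0] by simp
  then have 1: "(\<lambda>t. (1 + h t) powr p - 1) \<in> o[at_right 0](\<lambda>t. t)"
    using h landau_o.big_small_trans by blast
  have "((\<lambda>t. g t powr p) \<longlongrightarrow> r powr p) (at_right 0)"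
    using assms by (intro tendsto_intros) auto
  then have 2: "(\<lambda>t. g t powr p) \<in> O[at_right 0](\<lambda>_. 1)"
    by (intro bigoI_tendsto[of _ _ "r powr p"]) auto
  have "(\<lambda>t. g t powr p * ((1 + h t) powr p - 1)) \<in> o[at_right 0](\<lambda>t. t)"
    using landau_o.big_small_mult[OF 2 1] by simp
  moreover have "eventually (\<lambda>t. f t powr p - g t powr p = g t powr p * ((1 + h t) powr p - 1)) (at_right 0)"
    using pos by eventually_elim (simp add: h_def powr_divide field_simps)
  ultimately show ?thesis
    by (subst landau_o.small.in_cong)
qed

lemma inv_powr_abs:
  assumes "little_oh_poly f" "std_part (abs_fermat f) > 0"
  shows "little_oh_poly (\<lambda>t. f t powr p)" "inv_powr (abs_fermat f) p = abs_fermat (\<lambda>t. f t powr p)"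
proof -
  define g where "g = rep_fermat (abs_fermat f)"
  have g: "little_oh_poly g" "abs_fermat g = abs_fermat f"
    using Quotient3_rep_reflp[OF Quotient3_fermat, of "abs_fermat f"]
      Quotient3_abs_rep[OF Quotient3_fermat, of "abs_fermat f"]
    by (auto simp: g_def fermat_rel_def)
  have lim: "(f \<longlongrightarrow> std_part (abs_fermat f)) (at_right 0)" "(g \<longlongrightarrow> std_part (abs_fermat f)) (at_right 0)"
    using std_part_tendsto[OF assms(1)] std_part_tendsto[OF g(1)] g(2) by auto
  show f: "little_oh_poly (\<lambda>t. f t powr p)"
    by (rule little_oh_poly_powr[OF assms(1) lim(1) assms(2)])
  have "(\<lambda>t. g t powr p - f t powr p) \<in> o[at_right 0](\<lambda>t. t)"
    using g assms by (intro powr_diff_smallo[OF lim(2,1) assms(2)]) (simp flip: abs_fermat_eq_iff)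
  then show "inv_powr (abs_fermat f) p = abs_fermat (\<lambda>t. f t powr p)"
    using f little_oh_poly_powr[OF g(1) lim(2) assms(2)]
    by (simp add: inv_powr_def abs_fermat_eq_iff flip: g_def)
qed

end

(*
  Each Fermat real has a canonical representative, the generalized polynomial with exponents in
  [0,1] read off its decomposition, and for t > 0 it is the only such polynomial in its class.
  The power of a positive Fermat real is the class of the pointwise power of the canonical
  representative. The hypothesis on the orders says exactly that multiplying the canonical
  representatives of x and y creates no exponent above 1, so their product is the canonical
  representative of x * y, and the claim reduces to (uv)^p = u^p v^p for positive real u and v.
*)
theory Submission
  imports Defs
begin

section \<open>Generalized polynomials\<close>

text \<open>Merges entries with equal exponents. Nothing is evaluated, exponent 0 included, so the
  identity holds at every real t, unlike \<open>gpoly_collect\<close>, which assumes t > 0.\<close>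

lemma gpoly_eq_sum:
  assumes "finite A" "snd ` set cs \<subseteq> A"
  shows "\<exists>c. \<forall>t. gpoly cs t = (\<Sum>\<alpha>\<in>A. c \<alpha> * t powr \<alpha>)"
  using assms(2)
proof (induction cs)
  case Nil
  show ?case by (intro exI[of _ "\<lambda>_. 0"]) simp
next
  case (Cons d cs)
  obtain b \<beta> where d: "d = (b, \<beta>)" by (cases d)
  have \<beta>: "\<beta> \<in> A" using Cons.prems by (simp add: d)
  obtain c where c: "\<And>t. gpoly cs t = (\<Sum>\<alpha>\<in>A. c \<alpha> * t powr \<alpha>)"
    using Cons by auto
  have "gpoly (d # cs) t = (\<Sum>\<alpha>\<in>A. (c(\<beta> := c \<beta> + b)) \<alpha> * t powr \<alpha>)" for t
  proof -
    have "(\<Sum>\<alpha>\<in>A - {\<beta>}. (c(\<beta> := c \<beta> + b)) \<alpha> * t powr \<alpha>) = (\<Sum>\<alpha>\<in>A - {\<beta>}. c \<alpha> * t powr \<alpha>)"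
      by (intro sum.cong) auto
    then show ?thesis
      by (simp add: d c sum.remove[OF assms(1) \<beta>] algebra_simps)
  qed
  then show ?case by blast
qed

text \<open>Once equal exponents are merged and zero coefficients dropped, the list is strictly
  sorted, so \<open>gpoly_unique\<close> compares it with the empty list. This extends uniqueness to
  unsorted lists with repetitions and zero entries.\<close>

lemma gpoly_smallo_ident_imp_zero:
  assumes "gpoly cs \<in> o[at_right 0](\<lambda>t. t)" "\<forall>(a, \<alpha>)\<in>set cs. \<alpha> \<le> 1"
  shows "gpoly cs t = 0"
proof -
  obtain c where c: "\<And>t. gpoly cs t = (\<Sum>\<alpha>\<in>snd ` set cs. c \<alpha> * t powr \<alpha>)"
    using gpoly_eq_sum[of "snd ` set cs" cs] by auto
  define S where "S = {\<alpha>\<in>snd ` set cs. c \<alpha> \<noteq> 0}"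
  have S: "finite S" by (simp add: S_def)
  define ds where "ds = map (\<lambda>\<alpha>. (c \<alpha>, \<alpha>)) (sorted_list_of_set S)"
  have eq: "gpoly ds t = gpoly cs t" for t
  proof -
    have "gpoly ds t = (\<Sum>\<alpha>\<leftarrow>sorted_list_of_set S. c \<alpha> * t powr \<alpha>)"
      by (simp add: gpoly_def ds_def comp_def)
    also have "\<dots> = (\<Sum>\<alpha>\<in>S. c \<alpha> * t powr \<alpha>)"
      using S by (subst sum_list_distinct_conv_sum_set) auto
    also have "\<dots> = gpoly cs t"
      unfolding c by (rule sum.mono_neutral_left) (auto simp: S_def)
    finally show ?thesis .
  qed
  have "map snd ds = sorted_list_of_set S"
    by (simp add: ds_def comp_def)
  moreover have "\<forall>(a, \<alpha>)\<in>set ds. a \<noteq> 0 \<and> \<alpha> \<le> 1"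
    using assms(2) S by (fastforce simp: ds_def S_def)
  ultimately have "ds = []"
    using assms(1) by (intro gpoly_unique[of ds "[]"]) (auto simp: eq)
  then show ?thesis using eq[of t] by simp
qed

lemma gpoly_tendsto_0:
  assumes "\<forall>(a, \<alpha>)\<in>set cs. \<alpha> > 0"
  shows "(gpoly cs \<longlongrightarrow> 0) (at_right 0)"
proof -
  \<comment> \<open>\<open>t powr 0\<close> and 1 differ at t = 0, where
    \<open>0 powr 0 = 0\<close>.\<close>
  have "eventually (\<lambda>t::real. t powr 0 = 1) (at_right 0)"
    using eventually_pos_at_right_0 by eventually_elim simp
  then have "gpoly cs \<in> o[at_right 0](\<lambda>_. 1)"
    using gpoly_smallo[OF assms] by (subst (asm) landau_o.small.cong)
  from smalloD_tendsto[OF this] show ?thesis by simp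
qed

text \<open>Factors out a leading term, as the definition of the power of an infinitesimal requires.
  No sign condition on t appears because \<open>powr_add\<close> has none.\<close>

lemma gpoly_shift:
  assumes "a \<noteq> 0"
  shows "gpoly ((a, \<alpha>) # cs) t =
    a * t powr \<alpha> * (1 + gpoly (map (\<lambda>(b, \<beta>). (b / a, \<beta> - \<alpha>)) cs) t)"
proof (induction cs)
  case (Cons d cs)
  obtain b \<beta> where d: "d = (b, \<beta>)" by (cases d)
  have "t powr \<beta> = t powr \<alpha> * t powr (\<beta> - \<alpha>)"
    by (simp flip: powr_add)
  then show ?case using Cons assms by (simp add: d algebra_simps)
qed simp

text \<open>The product list is neither sorted nor merged; \<open>gpoly_std_terms_unique\<close>
  accepts it in this form.\<close>

definition gmult :: "(real \<times> real) list \<Rightarrow> (real \<times> real) list \<Rightarrow> (real \<times> real) list" where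
  "gmult cs ds = map (\<lambda>((a, \<alpha>), (b, \<beta>)). (a * b, \<alpha> + \<beta>)) (List.product cs ds)"

lemma gpoly_gmult: "gpoly (gmult cs ds) t = gpoly cs t * gpoly ds t"
proof (induction cs)
  case Nil
  show ?case by (simp add: gmult_def)
next
  case (Cons c cs)
  obtain a \<alpha> where c: "c = (a, \<alpha>)" by (cases c)
  have "gpoly (map (\<lambda>d. (a * fst d, \<alpha> + snd d)) ds) t = a * t powr \<alpha> * gpoly ds t"
    by (induction ds) (auto simp: powr_add algebra_simps)
  then show ?case
    using Cons by (simp add: gmult_def c comp_def case_prod_beta algebra_simps)
qed

lemma gpoly_uminus: "gpoly (map (\<lambda>(a, \<alpha>). (- a, \<alpha>)) cs) t = - gpoly cs t"
  by (induction cs) auto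


section \<open>Classes of functions\<close>

lemma little_oh_poly_eventually_cong:
  assumes "eventually (\<lambda>t. f t = g t) (at_right 0)" "little_oh_poly g"
  shows "little_oh_poly f" "abs_fermat f = abs_fermat g"
proof -
  have "eventually (\<lambda>t. f t - g t = 0) (at_right 0)"
    using assms(1) by eventually_elim simp
  then have *: "(\<lambda>t. f t - g t) \<in> o[at_right 0](\<lambda>t. t)"
    by (rule landau_o.small.in_cong[THEN iffD2, OF _ zero_in_smallo])
  show f: "little_oh_poly f"
    using assms(2) * by (rule little_oh_poly_cong)
  show "abs_fermat f = abs_fermat g"
    using * f assms(2) by (simp add: abs_fermat_eq_iff)
qed

lemma abs_fermat_mult:
  "little_oh_poly f \<Longrightarrow> little_oh_poly g \<Longrightarrow> abs_fermat f * abs_fermat g = abs_fermat (\<lambda>t. f t * g t)"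
  by (subst times_fermat.abs_eq) (auto simp: fermat_rel_def)

lemma std_part_abs_eqI:
  assumes "little_oh_poly f" "(f \<longlongrightarrow> r) (at_right 0)"
  shows "std_part (abs_fermat f) = r"
  using tendsto_unique[OF _ std_part_tendsto[OF assms(1)] assms(2)] by simp

text \<open>For every w > 0, \<open>dt w\<close> is by definition the class of
  \<open>t powr (1 / w)\<close>, even if w < 1 makes it zero. So only positivity has to be checked
  for the orders \<open>v \<ominus>\<^sub>o w\<close> in the base of a power.\<close>

lemma sum_list_dt_pos:
  assumes "\<forall>(a, w)\<in>set cs. w > 0"
  shows "little_oh_poly (gpoly (gterms cs))"
    "(\<Sum>(a, w)\<leftarrow>cs. a *\<^sub>R dt w) = abs_fermat (gpoly (gterms cs))"
proof -
  have lop: "little_oh_poly (gpoly (gterms cs))" if "\<forall>(a, w)\<in>set cs. w > 0" for cs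
    using that by (intro little_oh_poly_gpoly) (fastforce simp: gterms_def)
  then show "little_oh_poly (gpoly (gterms cs))" using assms by blast
  show "(\<Sum>(a, w)\<leftarrow>cs. a *\<^sub>R dt w) = abs_fermat (gpoly (gterms cs))"
    using assms
  proof (induction cs)
    case Nil
    show ?case by (simp add: zero_fermat_def gterms_def gpoly_def[abs_def])
  next
    case (Cons c cs)
    obtain a w where c: "c = (a, w)" by (cases c)
    have w: "w > 0" and cs: "\<forall>(a, w)\<in>set cs. w > 0"
      using Cons.prems by (auto simp: c)
    have "a *\<^sub>R dt w = abs_fermat (\<lambda>t. a * t powr (1 / w))"
      using w little_oh_poly_monom[of "1 / w" 1] by (simp add: dt_def abs_fermat_scaleR)
    moreover have "gpoly (gterms (c # cs)) = (\<lambda>t. a * t powr (1 / w) + gpoly (gterms cs) t)"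
      by (simp add: gterms_def c fun_eq_iff)
    ultimately show ?case
      using Cons w lop[OF cs] by (simp add: c abs_fermat_add little_oh_poly_monom)
  qed
qed


section \<open>The canonical representative\<close>

text \<open>The standard part, possibly 0, is stored with exponent 0 so that the representative is a
  single \<open>gpoly\<close>. As \<open>0 powr 0 = 0\<close>, it is lost at t = 0, which the germ
  at 0 from the right does not see.\<close>

definition std_terms :: "fermat \<Rightarrow> (real \<times> real) list" where
  "std_terms x = (std_part x, 0) # gterms (inf_terms x)"

lemma inf_terms_props:
  "\<forall>(a, w)\<in>set (inf_terms x). a \<noteq> 0 \<and> w \<ge> 1" "sorted_wrt (>) (map snd (inf_terms x))"
  using is_decomposition_inf_terms[of x] by (auto simp: is_decomposition_def)

lemma std_terms_exponents: "\<forall>(a, \<alpha>)\<in>set (std_terms x). 0 \<le> \<alpha> \<and> \<alpha> \<le> 1"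
  using inf_terms_props(1)[of x] by (fastforce simp: std_terms_def gterms_def)

lemma little_oh_poly_std_terms: "little_oh_poly (gpoly (std_terms x))"
  using std_terms_exponents[of x] by (intro little_oh_poly_gpoly) auto

lemma eventually_gpoly_std_terms:
  "eventually (\<lambda>t. gpoly (std_terms x) t = std_part x + gpoly (gterms (inf_terms x)) t) (at_right 0)"
  using eventually_pos_at_right_0 by eventually_elim (simp add: std_terms_def)

lemma abs_fermat_std_terms: "abs_fermat (gpoly (std_terms x)) = x"
proof -
  have cs: "\<forall>(a, w)\<in>set (inf_terms x). w \<ge> 1"
    using inf_terms_props(1)[of x] by auto
  have "x = of_real (std_part x) + (\<Sum>(a, w)\<leftarrow>inf_terms x. a *\<^sub>R dt w)"
    using is_decomposition_inf_terms[of x] by (simp add: is_decomposition_def)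
  also have "\<dots> = abs_fermat (\<lambda>t. std_part x + gpoly (gterms (inf_terms x)) t)"
    using cs by (simp add: sum_list_dt of_real_fermat abs_fermat_add little_oh_poly_const
        little_oh_poly_gterms)
  also have "\<dots> = abs_fermat (gpoly (std_terms x))"
    using cs by (intro little_oh_poly_eventually_cong(2)[symmetric] eventually_gpoly_std_terms
        little_oh_poly_add little_oh_poly_const little_oh_poly_gterms)
  finally show ?thesis ..
qed

lemma std_terms_tendsto: "(gpoly (std_terms x) \<longlongrightarrow> std_part x) (at_right 0)"
  using std_part_tendsto[OF little_oh_poly_std_terms, of x] by (simp add: abs_fermat_std_terms)

text \<open>The difference of the two sides is o(t) and has exponents at most 1, hence vanishes
  identically. A canonical representative can thus be recognized from its exponents alone, without
  computing the decomposition.\<close>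

lemma gpoly_std_terms_unique:
  assumes "\<forall>(a, \<alpha>)\<in>set cs. 0 \<le> \<alpha> \<and> \<alpha> \<le> 1"
  shows "gpoly (std_terms (abs_fermat (gpoly cs))) t = gpoly cs t"
proof -
  define ds where "ds = std_terms (abs_fermat (gpoly cs))"
  define es where "es = ds @ map (\<lambda>(a, \<alpha>). (- a, \<alpha>)) cs"
  have eq: "gpoly es = (\<lambda>t. gpoly ds t - gpoly cs t)"
    unfolding fun_eq_iff by (simp add: es_def gpoly_uminus)
  have lop: "little_oh_poly (gpoly cs)" using assms by (intro little_oh_poly_gpoly) auto
  have "(\<lambda>t. gpoly ds t - gpoly cs t) \<in> o[at_right 0](\<lambda>t. t)"
    unfolding ds_def using lop little_oh_poly_std_terms
    by (simp add: abs_fermat_std_terms flip: abs_fermat_eq_iff)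
  then have "gpoly es \<in> o[at_right 0](\<lambda>t. t)"
    by (simp add: eq)
  moreover have "\<forall>(a, \<alpha>)\<in>set es. \<alpha> \<le> 1"
    using assms std_terms_exponents[of "abs_fermat (gpoly cs)"] by (fastforce simp: es_def ds_def)
  ultimately have "gpoly es t = 0"
    by (rule gpoly_smallo_ident_imp_zero)
  then show ?thesis by (simp add: eq ds_def)
qed

section \<open>Leading terms and positivity\<close>

text \<open>
  The factor \<open>1 + h t\<close> is the base of the power in the second case of \<open>fermat_powr_def\<close>.
\<close>

lemma infinitesimal_leading_factor:
  assumes "std_part x = 0" "inf_terms x = (a, w) # cs"
  defines "h \<equiv> gpoly (gterms (map (\<lambda>(b, v). (b / a, v \<ominus>\<^sub>o w)) cs))"
  shows "(\<Sum>i=2..num_terms x. (coef x i / coef x 1) *\<^sub>R dt (omega x i \<ominus>\<^sub>o omega x 1)) = abs_fermat h"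
    "little_oh_poly h" "(h \<longlongrightarrow> 0) (at_right 0)"
    "gpoly (std_terms x) t = a * t powr (1 / w) * (1 + h t)"
proof -
  have a: "a \<noteq> 0" and cs: "\<forall>(b, v)\<in>set cs. v \<ge> 1 \<and> v < w"
    using inf_terms_props[of x] by (auto simp: assms(2))
  define ds where "ds = map (\<lambda>(b, v). (b / a, v \<ominus>\<^sub>o w)) cs"
  have ds: "\<forall>(b, v)\<in>set ds. v > 0"
    using cs by (fastforce simp: ds_def oominus_def intro: frac_less2)
  have h: "h = gpoly (gterms ds)" by (simp add: h_def ds_def)
  show "little_oh_poly h"
    unfolding h by (rule sum_list_dt_pos(1)[OF ds])
  show "(h \<longlongrightarrow> 0) (at_right 0)"
    unfolding h using ds by (intro gpoly_tendsto_0) (fastforce simp: gterms_def)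
  have "(\<Sum>i=2..num_terms x. (coef x i / coef x 1) *\<^sub>R dt (omega x i \<ominus>\<^sub>o omega x 1)) =
        (\<Sum>i<length cs. (fst (cs ! i) / a) *\<^sub>R dt (snd (cs ! i) \<ominus>\<^sub>o w))"
  proof (rule sum.reindex_bij_witness[of _ "\<lambda>i. i + 2" "\<lambda>i. i - 2"])
    fix i assume "i \<in> {2..num_terms x}"
    then show "i - 2 \<in> {..<length cs}" "i - 2 + 2 = i"
      by (auto simp: num_terms_def assms(2))
    \<comment> \<open>Summand i sits at list position i - 1, hence at position i - 2 of the tail
      \<open>cs\<close>.\<close>
    have "inf_terms x ! (i - 1) = cs ! (i - 2)"
      using \<open>i \<in> {2..num_terms x}\<close> by (simp add: assms(2) nth_Cons' numeral_2_eq_2)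
    then show "(fst (cs ! (i - 2)) / a) *\<^sub>R dt (snd (cs ! (i - 2)) \<ominus>\<^sub>o w) =
        (coef x i / coef x 1) *\<^sub>R dt (omega x i \<ominus>\<^sub>o omega x 1)"
      by (simp add: coef_def omega_def assms(2))
  qed (auto simp: num_terms_def assms(2))
  also have "\<dots> = (\<Sum>(b, v)\<leftarrow>ds. b *\<^sub>R dt v)"
    by (simp add: ds_def sum_list_sum_nth case_prod_beta atLeast0LessThan)
  also have "\<dots> = abs_fermat h"
    unfolding h by (rule sum_list_dt_pos(2)[OF ds])
  finally show "(\<Sum>i=2..num_terms x. (coef x i / coef x 1) *\<^sub>R dt (omega x i \<ominus>\<^sub>o omega x 1)) = abs_fermat h" .
  \<comment> \<open>The exponent of order \<open>v \<ominus>\<^sub>o w\<close> is 1/v - 1/w: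
    dividing by the leading power \<open>t powr (1 / w)\<close> turns order v into
    \<open>v \<ominus>\<^sub>o w\<close>.\<close>
  have "gterms ds = map (\<lambda>(b, \<beta>). (b / a, \<beta> - 1 / w)) (gterms cs)"
    by (simp add: gterms_def ds_def oominus_def case_prod_beta inverse_eq_divide)
  then show "gpoly (std_terms x) t = a * t powr (1 / w) * (1 + h t)"
    unfolding h using gpoly_shift[OF a, of "1 / w" "gterms cs" t]
    by (simp add: std_terms_def assms(1,2) gterms_def)
qed

lemma eventually_one_plus_pos:
  fixes h :: "real \<Rightarrow> real"
  assumes "(h \<longlongrightarrow> 0) F"
  shows "eventually (\<lambda>t. 1 + h t > 0) F"
  using order_tendstoD(1)[OF assms, of "-1"] by (auto elim: eventually_mono)

lemma inf_terms_eq_Nil_iff: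
  assumes "std_part x = 0"
  shows "inf_terms x = [] \<longleftrightarrow> x = 0"
proof
  assume "inf_terms x = []"
  then show "x = 0"
    using is_decomposition_inf_terms[of x] assms by (simp add: is_decomposition_def)
next
  assume "x = 0"
  then have "is_decomposition x 0 []" by (simp add: is_decomposition_def)
  then show "inf_terms x = []"
    using is_decomposition_unique is_decomposition_inf_terms by blast
qed

text \<open>A nonzero standard part is the limit of the representative and decides its sign.
  Otherwise the leading coefficient does, since the remaining factors are eventually positive. In
  this form positivity passes to products.\<close>

lemma fermat_pos_iff_eventually:
  "fermat_pos x \<longleftrightarrow> eventually (\<lambda>t. gpoly (std_terms x) t > 0) (at_right 0)"
proof (cases "std_part x = 0")
  case False
  show ?thesis
  proof
    assume "fermat_pos x"
    with False have "std_part x > 0" by (simp add: fermat_pos_def)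
    then show "eventually (\<lambda>t. gpoly (std_terms x) t > 0) (at_right 0)"
      using order_tendstoD(1)[OF std_terms_tendsto] by blast
  next
    assume "eventually (\<lambda>t. gpoly (std_terms x) t > 0) (at_right 0)"
    then have "eventually (\<lambda>t. 0 \<le> gpoly (std_terms x) t) (at_right 0)"
      by eventually_elim simp
    then have "std_part x \<ge> 0"
      by (intro tendsto_lowerbound[OF std_terms_tendsto]) auto
    with False show "fermat_pos x" by (simp add: fermat_pos_def)
  qed
next
  case r: True
  show ?thesis
  proof (cases "inf_terms x")
    case Nil
    then show ?thesis
      using r inf_terms_eq_Nil_iff[OF r]
      by (simp add: fermat_pos_def std_terms_def gterms_def)
  next
    case (Cons c cs)
    obtain a w where c: "c = (a, w)" by (cases c)
    note lead = infinitesimal_leading_factor[OF r, of a w cs]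
    define h where "h = gpoly (gterms (map (\<lambda>(b, v). (b / a, v \<ominus>\<^sub>o w)) cs))"
    have eq: "gpoly (std_terms x) t = a * t powr (1 / w) * (1 + h t)" for t
      using lead(4) Cons c by (simp add: h_def)
    have "(h \<longlongrightarrow> 0) (at_right 0)"
      using lead(3) Cons c by (simp add: h_def)
    from eventually_one_plus_pos[OF this] eventually_pos_at_right_0
    have *: "eventually (\<lambda>t. gpoly (std_terms x) t > 0 \<longleftrightarrow> a > 0) (at_right 0)"
      by eventually_elim (simp add: eq zero_less_mult_iff)
    have "fermat_pos x \<longleftrightarrow> a > 0"
      using r Cons c inf_terms_eq_Nil_iff[OF r] by (simp add: fermat_pos_def coef_def)
    also have "\<dots> \<longleftrightarrow> eventually (\<lambda>t. gpoly (std_terms x) t > 0) (at_right 0)"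
      \<comment> \<open>The condition a > 0 does not depend on t, and \<open>at_right 0\<close> is a
        nontrivial filter.\<close>
      by (subst eventually_subst[OF *]) (simp add: eventually_const_iff)
    finally show ?thesis .
  qed
qed

section \<open>Powers and products through canonical representatives\<close>

text \<open>Unites the two cases of the definition of powers. For an infinitesimal, the three
  factors there are the p-th powers of the coefficient, the leading power of t and the factor
  tending to 1, whose product is the representative.\<close>

lemma fermat_powr_std_terms:
  assumes "fermat_pos x" "p > 0"
  shows "little_oh_poly (\<lambda>t. gpoly (std_terms x) t powr p)"
    "fermat_powr x p = abs_fermat (\<lambda>t. gpoly (std_terms x) t powr p)"
proof -
  have "little_oh_poly (\<lambda>t. gpoly (std_terms x) t powr p) \<and>
    fermat_powr x p = abs_fermat (\<lambda>t. gpoly (std_terms x) t powr p)"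
  proof (cases "std_part x > 0")
    case True
    then show ?thesis
      using inv_powr_abs[OF little_oh_poly_std_terms, of x p]
      by (simp add: abs_fermat_std_terms fermat_powr_def)
  next
    case False
    then have r: "std_part x = 0" and x: "x \<noteq> 0" "coef x 1 > 0"
      using assms(1) by (auto simp: fermat_pos_def)
    obtain a w cs where cs: "inf_terms x = (a, w) # cs"
      using x(1) inf_terms_eq_Nil_iff[OF r] by (cases "inf_terms x") auto
    have a: "a > 0" "coef x (Suc 0) = a" "omega x (Suc 0) = w"
      using x(2) cs by (auto simp: coef_def omega_def)
    have w: "w \<ge> 1" using inf_terms_props(1)[of x] by (simp add: cs)
    define h where "h = gpoly (gterms (map (\<lambda>(b, v). (b / a, v \<ominus>\<^sub>o w)) cs))"
    note lead = infinitesimal_leading_factor[OF r cs, folded h_def]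
    define k where "k = (\<lambda>t. 1 + h t)"
    have k: "little_oh_poly k" "(k \<longlongrightarrow> 1) (at_right 0)"
      unfolding k_def using lead(2) tendsto_add[OF tendsto_const lead(3), of 1]
      by (auto intro: little_oh_poly_add little_oh_poly_const)
    have "1 + abs_fermat h = abs_fermat k"
      unfolding k_def one_fermat_def
      by (intro abs_fermat_add little_oh_poly_const lead(2))
    moreover have "std_part (abs_fermat k) > 0"
      using std_part_abs_eqI[OF k] by simp
    note kp = inv_powr_abs[OF k(1) this, of p]
    \<comment> \<open>Only w / p > 0 is at stake: for p > w both sides are zero.\<close>
    moreover have dt: "dt (w / p) = abs_fermat (\<lambda>t. t powr (p / w))"
      using w assms(2) by (simp add: dt_def)
    have m: "little_oh_poly (\<lambda>t. t powr (p / w))"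
      using w assms(2) little_oh_poly_monom[of "p / w" 1] by simp
    ultimately have "fermat_powr x p = (a powr p *\<^sub>R abs_fermat (\<lambda>t. t powr (p / w))) * abs_fermat (\<lambda>t. k t powr p)"
      using False lead(1) by (simp add: fermat_powr_def a dt)
    also have "\<dots> = abs_fermat (\<lambda>t. a powr p * t powr (p / w) * k t powr p)"
      using m kp(1) by (simp add: abs_fermat_scaleR abs_fermat_mult little_oh_poly_cmult)
    finally have eq: "fermat_powr x p = abs_fermat (\<lambda>t. a powr p * t powr (p / w) * k t powr p)" .
    have lop: "little_oh_poly (\<lambda>t. a powr p * t powr (p / w) * k t powr p)"
      by (intro little_oh_poly_mult[OF _ kp(1)] little_oh_poly_cmult m)
    \<comment> \<open>The power is distributed where all three factors are positive, that is for
      small t > 0.\<close>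
    have "eventually (\<lambda>t. gpoly (std_terms x) t powr p = a powr p * t powr (p / w) * k t powr p) (at_right 0)"
      using eventually_pos_at_right_0 eventually_one_plus_pos[OF lead(3)]
      by eventually_elim (use a in \<open>simp add: lead(4) k_def powr_mult powr_powr\<close>)
    from little_oh_poly_eventually_cong[OF this lop] show ?thesis
      by (simp add: eq)
  qed
  then show "little_oh_poly (\<lambda>t. gpoly (std_terms x) t powr p)"
    "fermat_powr x p = abs_fermat (\<lambda>t. gpoly (std_terms x) t powr p)" by auto
qed

text \<open>Exponents of the product are sums of one exponent from each factor. A sum with a
  standard part's exponent 0 stays at most 1; for two infinitesimal summands the bound is the
  hypothesis. Uniqueness of the representative then applies.\<close>

lemma gpoly_std_terms_mult:
  assumes "\<forall>i\<in>{1..num_terms y}. \<forall>j\<in>{1..num_terms x}. omega y i \<oplus>\<^sub>o omega x j \<ge> 1"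
  shows "gpoly (std_terms (x * y)) t = gpoly (std_terms x) t * gpoly (std_terms y) t"
proof -
  have ge: "v \<oplus>\<^sub>o w \<ge> 1" if xy: "(a, w) \<in> set (inf_terms x)" "(b, v) \<in> set (inf_terms y)" for a b v w
  proof -
    obtain i j where "i < num_terms y" "inf_terms y ! i = (b, v)" "j < num_terms x" "inf_terms x ! j = (a, w)"
      using xy unfolding in_set_conv_nth num_terms_def by blast
    then show ?thesis
      using assms[rule_format, of "Suc i" "Suc j"] by (simp add: omega_def)
  qed
  \<comment> \<open>An inverse is at least 1 exactly when its argument lies in (0,1].\<close>
  have le: "1 / w + 1 / v \<le> 1"
    if xy: "(a, w) \<in> set (inf_terms x)" "(b, v) \<in> set (inf_terms y)" for a b v w
    using ge[OF xy] unfolding ooplus_def one_le_inverse_iff by simp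
  have "\<forall>(c, \<gamma>)\<in>set (gmult (std_terms x) (std_terms y)). 0 \<le> \<gamma> \<and> \<gamma> \<le> 1"
  proof (clarsimp simp: gmult_def)
    fix a \<alpha> b \<beta> assume *: "(a, \<alpha>) \<in> set (std_terms x)" "(b, \<beta>) \<in> set (std_terms y)"
    have "0 \<le> \<alpha>" "\<alpha> \<le> 1" "0 \<le> \<beta>" "\<beta> \<le> 1"
      using * std_terms_exponents[of x] std_terms_exponents[of y] by auto
    then show "0 \<le> \<alpha> + \<beta> \<and> \<alpha> + \<beta> \<le> 1"
      using * le by (auto simp: std_terms_def gterms_def)
  qed
  from gpoly_std_terms_unique[OF this]
  have "gpoly (std_terms (abs_fermat (gpoly (gmult (std_terms x) (std_terms y))))) t =
    gpoly (std_terms x) t * gpoly (std_terms y) t"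
    by (simp add: gpoly_gmult)
  moreover have "abs_fermat (gpoly (gmult (std_terms x) (std_terms y))) = x * y"
    using abs_fermat_mult[OF little_oh_poly_std_terms little_oh_poly_std_terms, of x y]
    by (simp add: abs_fermat_std_terms gpoly_gmult[abs_def])
  ultimately show ?thesis by simp
qed

theorem theorem40:
  fixes x y :: fermat and p :: real
  assumes "fermat_pos x" and "fermat_pos y" and "p > 0"
    and "\<forall>i\<in>{1..num_terms y}. \<forall>j\<in>{1..num_terms x}. omega y i \<oplus>\<^sub>o omega x j \<ge> 1"
  shows "fermat_powr (x * y) p = fermat_powr x p * fermat_powr y p"
proof -
  note mult = gpoly_std_terms_mult[OF assms(4)]
  have pos: "eventually (\<lambda>t. gpoly (std_terms x) t > 0 \<and> gpoly (std_terms y) t > 0) (at_right 0)"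
    using assms(1,2) by (simp add: fermat_pos_iff_eventually eventually_conj_iff)
  \<comment> \<open>\<open>fermat_powr_std_terms\<close> needs positivity of the product, which the
    pointwise factorization of its representative yields.\<close>
  then have "fermat_pos (x * y)"
    unfolding fermat_pos_iff_eventually by eventually_elim (simp add: mult)
  then have "fermat_powr (x * y) p = abs_fermat (\<lambda>t. gpoly (std_terms (x * y)) t powr p)"
    using assms(3) by (rule fermat_powr_std_terms)
  also have "\<dots> = abs_fermat (\<lambda>t. gpoly (std_terms x) t powr p * gpoly (std_terms y) t powr p)"
  proof (rule little_oh_poly_eventually_cong(2))
    show "eventually (\<lambda>t. gpoly (std_terms (x * y)) t powr p =
        gpoly (std_terms x) t powr p * gpoly (std_terms y) t powr p) (at_right 0)"
      using pos by eventually_elim (simp add: mult powr_mult)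
    show "little_oh_poly (\<lambda>t. gpoly (std_terms x) t powr p * gpoly (std_terms y) t powr p)"
      using assms by (intro little_oh_poly_mult fermat_powr_std_terms(1))
  qed
  also have "\<dots> = fermat_powr x p * fermat_powr y p"
    using assms by (simp add: fermat_powr_std_terms abs_fermat_mult)
  finally show ?thesis .
qed

end
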